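(* Let $\alpha>1$, $\beta>0$, and let $\mathcal{P}=\{0=t_0<t_1<\cdots<t_N=T\}$ be a partition of $[0,T]$ with mesh $\delta:=\max_{0\le i\le N-1}(t_{i+1}-t_i)$. Write $\Delta_i:=t_{i+1}-t_i$. Then $$\Sigma(\mathcal{P}):=\sum_{i,j=0}^{N-1}\Delta_i^{\alpha}\,\Delta_j^{\alpha}\,e^{-\beta|t_i-t_j|}\;\le\; C(\alpha,\beta,T)\,\delta^{2\alpha-2},$$ where $$C(\alpha,\beta,T)=T+\frac{2T}{\beta}(1+c_0)$$ for some absolute constant $c_0>0$, and $C(\alpha,\beta,T)$ is bounded uniformly in $\delta\in(0,1]$.
   Context: Here $T>0$ is a fixed time horizon and $N\ge 1$ is the number of subintervals of the partition.
   Formalization: The estimate is stated for partitions with mesh δ ≤ 1, the range named in the last clause; for unrestricted δ it fails with an absolute c_0 (N=1, δ=T=3, β=2(1+c_0)). *)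

theory Defs
  imports Complex_Main
begin

text \<open>The partition points are \<open>t 0, \<dots>, t N\<close>; the values of \<open>t\<close> beyond \<open>N\<close> are irrelevant.\<close>

definition is_partition :: "real \<Rightarrow> nat \<Rightarrow> (nat \<Rightarrow> real) \<Rightarrow> bool" where
  "is_partition T N t \<longleftrightarrow> N \<ge> 1 \<and> t 0 = 0 \<and> t N = T \<and> (\<forall>i<N. t i < t (Suc i))"

definition step :: "(nat \<Rightarrow> real) \<Rightarrow> nat \<Rightarrow> real" where
  "step t i = t (Suc i) - t i"

definition mesh :: "nat \<Rightarrow> (nat \<Rightarrow> real) \<Rightarrow> real" where
  "mesh N t = Max (step t ` {..<N})"

definition Sigma_sum :: "real \<Rightarrow> real \<Rightarrow> nat \<Rightarrow> (nat \<Rightarrow> real) \<Rightarrow> real" where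
  "Sigma_sum \<alpha> \<beta> N t =
     (\<Sum>i<N. \<Sum>j<N. step t i powr \<alpha> * step t j powr \<alpha> * exp (- \<beta> * \<bar>t i - t j\<bar>))"

text \<open>The formula does not involve \<open>\<alpha>\<close>; the argument is kept to match \<open>C(\<alpha>, \<beta>, T)\<close>.
  The absolute constant \<open>c\<^sub>0\<close> is made an explicit parameter.\<close>

definition C_const :: "real \<Rightarrow> real \<Rightarrow> real \<Rightarrow> real \<Rightarrow> real" where
  "C_const c0 \<alpha> \<beta> T = T + 2 * T / \<beta> * (1 + c0)"

end

theory Submission
  imports Defs
begin

text \<open>Since \<open>\<Delta>\<^sub>i powr \<alpha> \<le> \<Delta>\<^sub>i * \<delta> powr (\<alpha> - 1)\<close>, it suffices to treat \<open>\<alpha> = 1\<close>. The diagonal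
  then contributes at most \<open>\<delta> * T \<le> T\<close>. Below the diagonal, the sum over \<open>j < i\<close> is a lower
  Riemann sum of the increasing function \<open>s \<mapsto> exp (- \<beta> * (t i - s))\<close>, hence at most \<open>1 / \<beta>\<close>;
  the part above the diagonal is equal to it by symmetry. So every positive \<open>c\<^sub>0\<close> is admissible.\<close>

text \<open>Enlarging the square from \<open>N\<close> to \<open>Suc N\<close> adds one diagonal
  term, a row and a column; by symmetry the last two have equal sums.\<close>

lemma sum_square_symmetric:
  fixes g :: "nat \<Rightarrow> nat \<Rightarrow> 'a::comm_semiring_1"
  assumes "\<And>i j. g i j = g j i"
  shows "(\<Sum>i<N. \<Sum>j<N. g i j) = (\<Sum>i<N. g i i) + 2 * (\<Sum>i<N. \<Sum>j<i. g i j)"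
proof (induction N)
  case (Suc N)
  have "(\<Sum>i<N. g i N) = (\<Sum>i<N. g N i)"
    using assms by (rule sum.cong[OF refl])
  then show ?case
    using Suc by (simp add: sum.distrib algebra_simps mult_2)
qed simp

lemma is_partition_mono:
  assumes "is_partition T N t" "i \<le> j" "j \<le> N"
  shows "t i \<le> t j"
  using assms(2,3)
proof (induction j rule: dec_induct)
  case (step n)
  then have "t i \<le> t n" "t n < t (Suc n)"
    using assms(1) by (auto simp: is_partition_def)
  then show ?case
    by simp
qed simp

lemma step_pos: "is_partition T N t \<Longrightarrow> i < N \<Longrightarrow> 0 < step t i"
  by (simp add: is_partition_def step_def)

lemma step_le_mesh: "i < N \<Longrightarrow> step t i \<le> mesh N t"
  by (simp add: mesh_def)

lemma sum_step:
  assumes "is_partition T N t"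
  shows "(\<Sum>i<N. step t i) = T"
  using assms by (simp add: is_partition_def step_def sum_lessThan_telescope)

text \<open>The integral comparison is done discretely: \<open>1 + x \<le> exp x\<close> bounds
  \<open>\<beta>\<close> times each term by an increment of \<open>E\<close>, and the increments
  telescope.\<close>

lemma sum_step_exp_le:
  assumes "\<beta> > 0"
  shows "(\<Sum>j<i. step t j * exp (- \<beta> * (t i - t j))) \<le> 1 / \<beta>"
proof -
  define E where "E j = exp (- \<beta> * (t i - t j))" for j
  have "\<beta> * (step t j * E j) \<le> E (Suc j) - E j" for j
  proof -
    have "E (Suc j) = E j * exp (\<beta> * step t j)"
      by (simp add: E_def step_def algebra_simps flip: exp_add)
    moreover have "E j * (1 + \<beta> * step t j) \<le> E j * exp (\<beta> * step t j)"
      by (intro mult_left_mono exp_ge_add_one_self) (simp add: E_def)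
    ultimately show ?thesis
      by (simp add: algebra_simps)
  qed
  then have "(\<Sum>j<i. \<beta> * (step t j * E j)) \<le> (\<Sum>j<i. E (Suc j) - E j)"
    by (intro sum_mono)
  also have "\<dots> = E i - E 0"
    by (rule sum_lessThan_telescope)
  \<comment> \<open>\<open>E i = exp 0 = 1\<close>, and \<open>E 0\<close> is positive.\<close>
  also have "\<dots> \<le> 1"
    by (simp add: E_def)
  finally show ?thesis
    using assms by (simp add: E_def field_simps flip: sum_distrib_left)
qed

lemma Sigma_sum_one_le:
  assumes part: "is_partition T N t" and "mesh N t \<le> 1" and "\<beta> > 0"
  shows "Sigma_sum 1 \<beta> N t \<le> T + 2 * T / \<beta>"
proof -
  define g where "g i j = step t i * step t j * exp (- \<beta> * \<bar>t i - t j\<bar>)" for i j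
  have sym: "g i j = g j i" for i j
    by (simp add: g_def abs_minus_commute mult.commute)
  have diag: "(\<Sum>i<N. g i i) \<le> T"
  proof -
    \<comment> \<open>The exponential is 1 on the diagonal, and a step of length at most
      \<open>mesh N t \<le> 1\<close> dominates its square.\<close>
    have "g i i \<le> step t i" if "i < N" for i
      using step_pos[OF part that] step_le_mesh[OF that, of t] assms(2)
      by (simp add: g_def mult_left_le)
    then have "(\<Sum>i<N. g i i) \<le> (\<Sum>i<N. step t i)"
      by (intro sum_mono) simp
    then show ?thesis
      by (simp add: sum_step[OF part])
  qed
  have lower: "(\<Sum>i<N. \<Sum>j<i. g i j) \<le> T / \<beta>"
  proof -
    have "(\<Sum>j<i. g i j) \<le> step t i * (1 / \<beta>)" if "i < N" for i
    proof -
      \<comment> \<open>For \<open>j < i\<close> monotonicity of the partition points removes the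
        absolute value.\<close>
      have "(\<Sum>j<i. g i j) = step t i * (\<Sum>j<i. step t j * exp (- \<beta> * (t i - t j)))"
        using is_partition_mono[OF part] that
        by (simp add: g_def sum_distrib_left mult.assoc)
      also have "\<dots> \<le> step t i * (1 / \<beta>)"
        using step_pos[OF part that] sum_step_exp_le[OF \<open>\<beta> > 0\<close>]
        by (intro mult_left_mono) auto
      finally show ?thesis .
    qed
    then have "(\<Sum>i<N. \<Sum>j<i. g i j) \<le> (\<Sum>i<N. step t i * (1 / \<beta>))"
      by (intro sum_mono) simp
    also have "\<dots> = T / \<beta>"
      by (simp add: sum_step[OF part] flip: sum_divide_distrib)
    finally show ?thesis .
  qed
  \<comment> \<open>\<open>x powr 1\<close> simplifies to \<open>x\<close> because the steps are
    positive.\<close>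
  have "Sigma_sum 1 \<beta> N t = (\<Sum>i<N. \<Sum>j<N. g i j)"
    unfolding Sigma_sum_def g_def
    by (intro sum.cong refl) (simp add: step_pos[OF part] less_imp_le)
  also have "\<dots> = (\<Sum>i<N. g i i) + 2 * (\<Sum>i<N. \<Sum>j<i. g i j)"
    using sym by (rule sum_square_symmetric)
  finally show ?thesis
    using diag lower by simp
qed

text \<open>Each of the two step factors gives up the power \<open>\<alpha> - 1\<close> to the mesh,
  hence the exponent \<open>2 * \<alpha> - 2\<close>.\<close>

lemma Sigma_sum_le_mesh_powr:
  assumes part: "is_partition T N t" and "\<alpha> \<ge> 1"
  shows "Sigma_sum \<alpha> \<beta> N t \<le> mesh N t powr (2 * \<alpha> - 2) * Sigma_sum 1 \<beta> N t"
proof -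
  define d where "d = mesh N t powr (\<alpha> - 1)"
  have step_powr: "step t i powr \<alpha> \<le> d * step t i" if "i < N" for i
  proof -
    have "step t i powr \<alpha> = step t i powr (\<alpha> - 1) * step t i"
      using step_pos[OF part that] by (simp add: powr_diff)
    also have "\<dots> \<le> d * step t i"
      unfolding d_def using step_pos[OF part that] step_le_mesh[OF that, of t] assms(2)
      by (intro mult_right_mono powr_mono2) auto
    finally show ?thesis .
  qed
  have "step t i powr \<alpha> * step t j powr \<alpha> * exp (- \<beta> * \<bar>t i - t j\<bar>)
      \<le> d * d * (step t i powr 1 * step t j powr 1 * exp (- \<beta> * \<bar>t i - t j\<bar>))"
    if "i < N" "j < N" for i j
  proof -
    have "step t i powr \<alpha> * step t j powr \<alpha> \<le> (d * step t i) * (d * step t j)"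
      using step_powr that step_pos[OF part] by (intro mult_mono) (auto simp: d_def less_imp_le)
    then have "step t i powr \<alpha> * step t j powr \<alpha> * exp (- \<beta> * \<bar>t i - t j\<bar>)
        \<le> (d * step t i) * (d * step t j) * exp (- \<beta> * \<bar>t i - t j\<bar>)"
      by (rule mult_right_mono) simp
    then show ?thesis
      using step_pos[OF part] that by (simp add: less_imp_le mult_ac)
  qed
  then have "Sigma_sum \<alpha> \<beta> N t \<le> d * d * Sigma_sum 1 \<beta> N t"
    unfolding Sigma_sum_def sum_distrib_left by (intro sum_mono) simp
  also have "d * d = mesh N t powr (2 * \<alpha> - 2)"
    by (simp add: d_def flip: powr_add)
  finally show ?thesis .
qed

text \<open>Choosing \<open>c0\<close> before all other variables makes it absolute. Uniformity for
  meshes in (0,1] is expressed by a constant that does not take the mesh as an argument.\<close>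

theorem lemma3p3:
  "\<exists>c0::real. c0 > 0 \<and>
     (\<forall>(\<alpha>::real) (\<beta>::real) (T::real). \<alpha> > 1 \<longrightarrow> \<beta> > 0 \<longrightarrow> T > 0 \<longrightarrow>
       (\<forall>(N::nat) (t::nat \<Rightarrow> real). is_partition T N t \<longrightarrow> mesh N t \<le> 1 \<longrightarrow>
          Sigma_sum \<alpha> \<beta> N t \<le> C_const c0 \<alpha> \<beta> T * mesh N t powr (2 * \<alpha> - 2)))"
\<comment> \<open>The bound \<open>T + 2 * T / \<beta>\<close> is \<open>C_const\<close> at
  \<open>c0 = 0\<close>; the witness 1 is an arbitrary positive choice.\<close>
proof (intro exI[of _ 1] conjI allI impI)
  fix \<alpha> \<beta> T :: real and N :: nat and t :: "nat \<Rightarrow> real"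
  assume "\<alpha> > 1" "\<beta> > 0" "T > 0" and part: "is_partition T N t" and "mesh N t \<le> 1"
  have "Sigma_sum 1 \<beta> N t \<le> T + 2 * T / \<beta>"
    using part \<open>mesh N t \<le> 1\<close> \<open>\<beta> > 0\<close> by (rule Sigma_sum_one_le)
  also have "\<dots> \<le> C_const 1 \<alpha> \<beta> T"
    using \<open>\<beta> > 0\<close> \<open>T > 0\<close> by (simp add: C_const_def field_simps)
  finally have "mesh N t powr (2 * \<alpha> - 2) * Sigma_sum 1 \<beta> N t
      \<le> mesh N t powr (2 * \<alpha> - 2) * C_const 1 \<alpha> \<beta> T"
    by (rule mult_left_mono) simp
  with Sigma_sum_le_mesh_powr[OF part, of \<alpha> \<beta>] \<open>\<alpha> > 1\<close>
  show "Sigma_sum \<alpha> \<beta> N t \<le> C_const 1 \<alpha> \<beta> T * mesh N t powr (2 * \<alpha> - 2)"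
    by (simp add: mult.commute)
qed simp

end
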